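(* Let $K$ be an infinite field of characteristic different from $2$ and $3$, and let $N$ be a commutative (not necessarily associative) algebra over $K$ satisfying the identity $x^3=0$. If $N$ satisfies the ascending chain condition on ideals, then $N$ is finite-dimensional over $K$.
   Context: Algebras over $K$ are not assumed associative, unital or finite-dimensional. In a commutative algebra, $x^3$ denotes $x^2x=xx^2$. The ascending chain condition on ideals means that every ascending sequence of ideals is stationary. *)

theory Defs
  imports Complex_Main "HOL-Computational_Algebra.Computational_Algebra"
begin

text \<open>
  Algebras over a field in the general sense: the product is only assumed bilinear (neither
  associative nor unital), so it is an explicit parameter instead of the type class operation.
  The algebra is the whole type \<open>'a\<close>.
\<close>

locale nonassoc_algebra = vector_space scale
  for scale :: "'k::field \<Rightarrow> 'a::ab_group_add \<Rightarrow> 'a" (infixr \<open>*s\<close> 75) +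
  fixes mult :: "'a \<Rightarrow> 'a \<Rightarrow> 'a" (infixl \<open>\<odot>\<close> 70)
  assumes mult_add_left: "(x + y) \<odot> z = x \<odot> z + y \<odot> z"
    and mult_add_right: "x \<odot> (y + z) = x \<odot> y + x \<odot> z"
    and mult_scale_left: "(c *s x) \<odot> y = c *s (x \<odot> y)"
    and mult_scale_right: "x \<odot> (c *s y) = c *s (x \<odot> y)"
begin

text \<open>
  Ideals are two-sided and are linear subspaces; without a unit, the latter does not follow from
  being an additive subgroup closed under multiplication by the algebra.
\<close>

definition alg_ideal :: "'a set \<Rightarrow> bool" where
  "alg_ideal I \<longleftrightarrow> subspace I \<and> (\<forall>x\<in>I. \<forall>a. a \<odot> x \<in> I \<and> x \<odot> a \<in> I)"

definition acc_on_ideals :: bool where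
  "acc_on_ideals \<longleftrightarrow>
     (\<forall>I :: nat \<Rightarrow> 'a set. (\<forall>n. alg_ideal (I n)) \<and> (\<forall>n. I n \<subseteq> I (Suc n)) \<longrightarrow>
        (\<exists>m. \<forall>n\<ge>m. I n = I m))"

end

locale commutative_nonassoc_algebra = nonassoc_algebra +
  assumes mult_commute: "x \<odot> y = y \<odot> x"

end

theory Submission
  imports Defs
begin

text \<open>
  Write \<open>L\<^sub>x\<close> for multiplication by \<open>x\<close>. Linearising \<open>x\<^sup>3 = 0\<close> yields the Jacobi identity, that is
  \<open>L\<^sub>x\<^sub>y = - (L\<^sub>x L\<^sub>y + L\<^sub>y L\<^sub>x)\<close>; it follows that the six products of \<open>L\<^sub>e\<close>, \<open>L\<^sub>f\<close>, \<open>L\<^sub>g\<close> in all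
  orders add up to zero (\<open>symmetrized_triple_zero\<close>).

  The heart of the proof is that, for a finite set \<open>X\<close>, all sufficiently long products of operators
  \<open>L\<^sub>x\<close> with \<open>x \<in> X\<close> vanish (\<open>finitely_many_multiplications_nilpotent\<close>). The method is
  that of Shirshov's theorem on special Jordan algebras. Number the elements of \<open>X\<close>, so that products of the
  operators become words, and order words of equal length lexicographically. Certain words, called
  Jordan words here, are the largest term in the expansion of a single operator \<open>L\<^sub>e\<close>. If a word has
  three adjacent factors that are Jordan words in weakly decreasing order, then the identity above
  rewrites it as a combination of smaller words (\<open>reducible_act_zero\<close>). Words without such factors
  have bounded length (\<open>irreducible_words_bounded\<close>); this is pure combinatorics. By lexicographic
  induction, all words of any length beyond the bound vanish.

  The chain condition then finishes the proof as in Nakayama's lemma. Let \<open>N\<^sup>k\<close> be the lower central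
  series. Every subspace that contains the ideal \<open>N\<^sup>2\<close> is an ideal, so \<open>N\<close> is spanned modulo \<open>N\<^sup>2\<close> by
  a finite set \<open>X\<close>, and \<open>N\<^sup>k\<close> is spanned modulo its successor by words in \<open>X\<close>. Since long words
  vanish, the series becomes stationary at an ideal \<open>I\<close> with \<open>I = N I\<close>. This ideal is finitely generated, and
  writing its generators in terms of themselves involves only finitely many operators; so
  \<open>I = 0\<close> by nilpotency (\<open>idempotent_ideal_zero\<close>), and \<open>N\<close> is spanned by finitely many words.
\<close>

section \<open>Dominance and Jordan words\<close>

text \<open>
  The words differ at some position that both have, and the first word is larger at the first such
  position. On words of equal length this is the lexicographic order. In general it is stronger than
  the lexicographic order: neither word is a prefix of the other, so the relation survives
  arbitrary extensions of both words.
\<close>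

fun dominates :: "nat list \<Rightarrow> nat list \<Rightarrow> bool" (infix \<open>\<ggreater>\<close> 50) where
  "a # u \<ggreater> b # v \<longleftrightarrow> b < a \<or> a = b \<and> u \<ggreater> v"
| "_ \<ggreater> _ \<longleftrightarrow> False"

lemma dominates_trans: "u \<ggreater> v \<Longrightarrow> v \<ggreater> w \<Longrightarrow> u \<ggreater> w"
proof (induction u v arbitrary: w rule: dominates.induct)
  case (1 a u b v)
  then show ?case by (cases w) auto
qed auto

lemma dominates_irrefl: "\<not> u \<ggreater> u"
  by (induction u) auto

lemma dominates_append: "u \<ggreater> v \<Longrightarrow> u @ s \<ggreater> v @ t"
  by (induction u v rule: dominates.induct) auto

lemma dominates_append1: "u \<ggreater> v \<Longrightarrow> u @ s \<ggreater> v"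
  using dominates_append[of u v s "[]"] by simp

lemma dominates_prepend: "p @ u \<ggreater> p @ v \<longleftrightarrow> u \<ggreater> v"
  by (induction p) auto

lemma dominates_imp_lex:
  "u \<ggreater> v \<Longrightarrow> length u = length v \<Longrightarrow> (v, u) \<in> lex less_than"
  by (induction u v rule: dominates.induct) auto

text \<open>
  If \<open>L\<^sub>e\<close> and \<open>L\<^sub>f\<close> have leading words \<open>u\<close> and \<open>v\<close>, then \<open>L\<^sub>e L\<^sub>f + L\<^sub>f L\<^sub>e\<close>, which is minus the operator
  of \<open>ef\<close>, has as leading word the larger one of \<open>uv\<close> and \<open>vu\<close>.
\<close>

inductive jordan_word :: "nat list \<Rightarrow> bool" where
  letter: "jordan_word [i]"
| product: "jordan_word u \<Longrightarrow> jordan_word v \<Longrightarrow> u \<ggreater> v \<Longrightarrow> jordan_word (u @ v)"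

text \<open>
  Comparing the two concatenations also makes sense when one word is a prefix of the other, as
  happens for a root and its descendants in the trees below.
\<close>

definition weakly_dominates :: "nat list \<Rightarrow> nat list \<Rightarrow> bool" (infix \<open>\<succeq>\<close> 50) where
  "u \<succeq> v \<longleftrightarrow> u = v \<or> u @ v \<ggreater> v @ u"

lemma weakly_dominates_refl: "u \<succeq> u"
  by (simp add: weakly_dominates_def)

lemma dominates_imp_weakly_dominates: "u \<ggreater> v \<Longrightarrow> u \<succeq> v"
  by (simp add: weakly_dominates_def dominates_append)

text \<open>
  The three comparisons make \<open>xyz\<close> the largest of the six products of \<open>x\<close>, \<open>y\<close>, \<open>z\<close>.
\<close>

definition reducible :: "nat list \<Rightarrow> bool" where
  "reducible w \<longleftrightarrow> (\<exists>p x y z q. w = p @ x @ y @ z @ q \<and> jordan_word x \<and> jordan_word y \<and> jordan_word z \<and>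
     x \<succeq> y \<and> y \<succeq> z \<and> x \<succeq> z)"

lemma reducibleI:
  "jordan_word x \<Longrightarrow> jordan_word y \<Longrightarrow> jordan_word z \<Longrightarrow> x \<succeq> y \<Longrightarrow> y \<succeq> z \<Longrightarrow> x \<succeq> z \<Longrightarrow>
   reducible (p @ x @ y @ z @ q)"
  unfolding reducible_def by blast

lemma reducible_append: "reducible w \<Longrightarrow> reducible (p @ w @ q)"
  unfolding reducible_def by (metis append.assoc)

section \<open>Irreducible words are bounded\<close>

text \<open>
  The bound is proved by eliminating letters. Let \<open>A\<close> be a finite set of Jordan words, used as
  letters, with smallest element \<open>y\<close>. In an irreducible word over \<open>A\<close> that starts with another letter,
  no letter \<open>z\<close> larger than \<open>y\<close> is followed by two copies of \<open>y\<close>, since \<open>zyy\<close> is reducible. Hence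
  the word is also a word over the letters \<open>z\<close> and \<open>zy\<close> with \<open>z\<close> in \<open>A - {y}\<close>, and it loses at most half of
  its length. The alphabet grows, and the point is to organise it such that the process
  stops.

  The letters that evolve from \<open>z\<close> when \<open>c\<^sub>1, \<dots>, c\<^sub>k\<close> are eliminated in this order are the words
  \<open>z\<close> followed by a subsequence of the \<open>c\<^sub>i\<close>. They form a binomial tree with root \<open>z\<close>, whose subtrees
  have the roots \<open>z c\<^sub>i\<close> and the remaining list \<open>c\<^sub>i\<^sub>+\<^sub>1, \<dots>, c\<^sub>k\<close>. An alphabet is a forest of such trees.
\<close>

fun tree :: "nat list \<Rightarrow> nat list list \<Rightarrow> nat list set" where
  "tree y [] = {y}"
| "tree y (c # C) = tree (y @ c) C \<union> tree y C"

fun subtrees :: "nat list \<Rightarrow> nat list list \<Rightarrow> (nat list \<times> nat list list) list" where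
  "subtrees y [] = []"
| "subtrees y (c # C) = (y @ c, C) # subtrees y C"

definition letters :: "(nat list \<times> nat list list) list \<Rightarrow> nat list set" where
  "letters F = (\<Union>(y, C) \<in> set F. tree y C)"

lemma letters_simps [simp]:
  "letters [] = {}" "letters ((y, C) # F) = tree y C \<union> letters F"
  by (auto simp: letters_def)

lemma tree_eq: "tree y C = insert y (letters (subtrees y C))"
  by (induction C) auto

lemma tree_snoc: "tree y (C @ [d]) = tree y C \<union> (\<lambda>z. z @ d) ` tree y C"
  by (induction C arbitrary: y) auto

lemma tree_extends: "z \<in> tree y C \<Longrightarrow> \<exists>s. z = y @ s"
proof (induction C arbitrary: y)
  case (Cons c C)
  then show ?case by (metis UnE append_assoc tree.simps(2))
qed simp

text \<open>
  The measure for the elimination: the list of the \<open>j\<close>-th tree has length at most \<open>k - j\<close>, counting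
  from \<open>1\<close>. Eliminating the first root removes one tree and lengthens each of the remaining lists by
  one, which keeps the bound; the subtrees of one tree satisfy it with a smaller \<open>k\<close>.
\<close>

fun fits :: "nat \<Rightarrow> (nat list \<times> nat list list) list \<Rightarrow> bool" where
  "fits k [] \<longleftrightarrow> True"
| "fits (Suc k) ((y, C) # F) \<longleftrightarrow> length C \<le> k \<and> fits k F"
| "fits 0 (t # F) \<longleftrightarrow> False"

text \<open>
  After elimination of \<open>d\<close>, every remaining letter \<open>z\<close> is accompanied by \<open>zd\<close>; in each tree this amounts to
  one more entry at the end of the list.
\<close>

definition graft :: "nat list \<Rightarrow> (nat list \<times> nat list list) list \<Rightarrow> (nat list \<times> nat list list) list" where
  "graft d F = map (\<lambda>(y, C). (y, C @ [d])) F"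

lemma letters_graft: "letters (graft d F) = letters F \<union> (\<lambda>z. z @ d) ` letters F"
  by (induction F) (auto simp: graft_def tree_snoc)

lemma fits_subtrees: "fits (length C) (subtrees y C)"
  by (induction C) auto

lemma fits_graft: "fits k F \<Longrightarrow> fits (Suc k) (graft d F)"
  by (induction k F rule: fits.induct) (auto simp: graft_def)

text \<open>
  Since dominance survives extension, comparing roots with roots and roots with the entries of the
  lists is enough to compare all letters of different trees.
\<close>

definition ordered_forest :: "(nat list \<times> nat list list) list \<Rightarrow> bool" where
  "ordered_forest F \<longleftrightarrow>
     (\<forall>(y, C) \<in> set F. jordan_word y \<and> (\<forall>c \<in> set C. jordan_word c) \<and> sorted_wrt (\<lambda>c d. d \<ggreater> c) C) \<and>
     sorted_wrt (\<lambda>(y, _) (z, _). z \<ggreater> y) F \<and>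
     (\<forall>(y, _) \<in> set F. \<forall>(_, C) \<in> set F. \<forall>c \<in> set C. y \<ggreater> c)"

lemma ordered_forest_dominates:
  assumes "ordered_forest F" "(y, C) \<in> set F" "(z, D) \<in> set F" "d \<in> set D"
  shows "y \<ggreater> d"
proof -
  have "\<forall>t \<in> set F. \<forall>s \<in> set F. \<forall>d \<in> set (snd s). fst t \<ggreater> d"
    using assms(1) by (simp add: ordered_forest_def case_prod_unfold)
  from this[rule_format, OF assms(2,3)] show ?thesis using assms(4) by simp
qed

lemma ordered_forest_entry:
  assumes "ordered_forest F" "(y, C) \<in> set F"
  shows "jordan_word y" "\<forall>c \<in> set C. jordan_word c" "\<forall>c \<in> set C. y \<ggreater> c"
    "sorted_wrt (\<lambda>c d. d \<ggreater> c) C"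
proof -
  have "\<forall>t \<in> set F. jordan_word (fst t) \<and> (\<forall>c \<in> set (snd t). jordan_word c) \<and>
      sorted_wrt (\<lambda>c d. d \<ggreater> c) (snd t)"
    using assms(1) by (simp add: ordered_forest_def case_prod_unfold)
  from this[rule_format, OF assms(2)]
  show "jordan_word y" "\<forall>c \<in> set C. jordan_word c" "sorted_wrt (\<lambda>c d. d \<ggreater> c) C"
    by simp_all
  show "\<forall>c \<in> set C. y \<ggreater> c"
    using ordered_forest_dominates[OF assms assms(2)] by blast
qed

lemma ordered_forest_Cons_dominates: "ordered_forest ((y, C) # F) \<Longrightarrow> (z, D) \<in> set F \<Longrightarrow> z \<ggreater> y"
  unfolding ordered_forest_def by auto

lemma set_subtrees: "t \<in> set (subtrees y C) \<Longrightarrow> \<exists>c D. t = (y @ c, D) \<and> c \<in> set C \<and> set D \<subseteq> set C"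
  by (induction C) auto

lemma set_subtrees_sorted:
  "t \<in> set (subtrees y C) \<Longrightarrow> sorted_wrt P C \<Longrightarrow> sorted_wrt P (snd t)"
  by (induction C) auto

lemma sorted_subtrees:
  "sorted_wrt (\<lambda>c d. d \<ggreater> c) C \<Longrightarrow> sorted_wrt (\<lambda>(y, _) (z, _). z \<ggreater> y) (subtrees y C)"
proof (induction C)
  case (Cons c C)
  then show ?case by (auto simp: dominates_prepend dest!: set_subtrees)
qed simp

lemma ordered_forest_subtrees:
  assumes "jordan_word y" "\<forall>c \<in> set C. jordan_word c" "sorted_wrt (\<lambda>c d. d \<ggreater> c) C"
    "\<forall>c \<in> set C. y \<ggreater> c"
  shows "ordered_forest (subtrees y C)"
  unfolding ordered_forest_def
proof (intro conjI)
  show "sorted_wrt (\<lambda>(y, _) (z, _). z \<ggreater> y) (subtrees y C)"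
    using assms sorted_subtrees by blast
  show "\<forall>(z, D) \<in> set (subtrees y C). jordan_word z \<and> (\<forall>c \<in> set D. jordan_word c) \<and>
      sorted_wrt (\<lambda>c d. d \<ggreater> c) D"
  proof clarify
    fix z D assume t: "(z, D) \<in> set (subtrees y C)"
    then obtain c where c: "z = y @ c" "c \<in> set C" "set D \<subseteq> set C"
      using set_subtrees by blast
    then show "jordan_word z \<and> (\<forall>c \<in> set D. jordan_word c) \<and> sorted_wrt (\<lambda>c d. d \<ggreater> c) D"
      using assms set_subtrees_sorted[OF t assms(3)] jordan_word.product by auto
  qed
  show "\<forall>(z, _) \<in> set (subtrees y C). \<forall>(_, D) \<in> set (subtrees y C). \<forall>c \<in> set D. z \<ggreater> c"
  proof clarify
    fix z D' y' D c
    assume "(z, D') \<in> set (subtrees y C)" "(y', D) \<in> set (subtrees y C)" "c \<in> set D"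
    then obtain b where "z = y @ b" "c \<in> set C"
      using set_subtrees by blast
    then show "z \<ggreater> c" using assms(4) dominates_append1 by blast
  qed
qed

lemma ordered_forest_graft:
  assumes "ordered_forest ((y, C) # F)"
  shows "ordered_forest (graft y F)"
  unfolding ordered_forest_def
proof (intro conjI)
  show "\<forall>(z, D) \<in> set (graft y F). jordan_word z \<and> (\<forall>c \<in> set D. jordan_word c) \<and>
      sorted_wrt (\<lambda>c d. d \<ggreater> c) D"
  proof clarify
    fix z D assume "(z, D) \<in> set (graft y F)"
    then obtain D' where "(z, D') \<in> set F" "D = D' @ [y]" by (auto simp: graft_def)
    then show "jordan_word z \<and> (\<forall>c \<in> set D. jordan_word c) \<and> sorted_wrt (\<lambda>c d. d \<ggreater> c) D"
      using assms by (auto simp: ordered_forest_def sorted_wrt_append)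
  qed
  show "sorted_wrt (\<lambda>(y, _) (z, _). z \<ggreater> y) (graft y F)"
    using assms by (auto simp: ordered_forest_def graft_def sorted_wrt_map case_prod_unfold)
  show "\<forall>(z, _) \<in> set (graft y F). \<forall>(_, D) \<in> set (graft y F). \<forall>c \<in> set D. z \<ggreater> c"
  proof clarify
    fix z D' z' D c
    assume "(z, D') \<in> set (graft y F)" "(z', D) \<in> set (graft y F)" "c \<in> set D"
    then obtain E' E where "(z, E') \<in> set F" "(z', E) \<in> set F" "c \<in> set E \<or> c = y"
      by (auto simp: graft_def)
    then show "z \<ggreater> c"
      using ordered_forest_dominates[OF assms, of z E' z' E c] ordered_forest_Cons_dominates[OF assms] by auto
  qed
qed

definition bounded_over :: "nat list set \<Rightarrow> bool" where
  "bounded_over A \<longleftrightarrow> (\<exists>b. \<forall>ls. set ls \<subseteq> A \<longrightarrow> \<not> reducible (concat ls) \<longrightarrow> length ls \<le> b)"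

lemma jordan_word_tree:
  "z \<in> tree y C \<Longrightarrow> jordan_word y \<Longrightarrow> \<forall>c \<in> set C. jordan_word c \<Longrightarrow> \<forall>c \<in> set C. y \<ggreater> c \<Longrightarrow>
   jordan_word z"
proof (induction C arbitrary: y)
  case (Cons c C)
  have "jordan_word (y @ c)" "\<forall>d \<in> set C. y @ c \<ggreater> d"
    using Cons.prems dominates_append1 by (auto intro: jordan_word.product)
  then show ?case using Cons by auto
qed simp

lemma subtrees_split:
  assumes "v \<in> letters (subtrees y C)"
  shows "\<exists>u c. v = u @ c \<and> u \<in> tree y C \<and> c \<in> set C"
  using assms
proof (induction C arbitrary: y)
  case (Cons c C)
  from Cons.prems consider "v = y @ c" | "v \<in> letters (subtrees (y @ c) C)" | "v \<in> letters (subtrees y C)"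
    by (auto simp: tree_eq)
  then show ?case
  proof cases
    case 1
    then show ?thesis using tree_eq[of y C] by auto
  next
    case 2
    then show ?thesis using Cons.IH[of "y @ c"] by auto
  next
    case 3
    then show ?thesis using Cons.IH[of y] by auto
  qed
qed simp

lemma root_weakly_dominates_tree:
  assumes "u \<in> tree y C" "\<forall>c \<in> set C. y \<ggreater> c"
  shows "y \<succeq> u"
proof (cases "u = y")
  case False
  then have "u \<in> letters (subtrees y C)"
    using assms(1) tree_eq[of y C] by blast
  then obtain z D where t: "(z, D) \<in> set (subtrees y C)" "u \<in> tree z D"
    unfolding letters_def by blast
  obtain c where c: "z = y @ c" "c \<in> set C"
    using set_subtrees[OF t(1)] by blast
  obtain s where s: "u = z @ s"
    using tree_extends[OF t(2)] by blast
  have "y @ c @ s \<ggreater> c @ s @ y"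
    using assms(2) c(2) by (intro dominates_append) blast
  then have "y @ y @ c @ s \<ggreater> y @ c @ s @ y"
    by (rule dominates_prepend[THEN iffD2])
  then have "y @ u \<ggreater> u @ y"
    unfolding s c(1) append_assoc .
  then show ?thesis
    unfolding weakly_dominates_def by blast
qed (simp add: weakly_dominates_def)

text \<open>
  A letter \<open>v\<close> below the root of the first tree has the form \<open>uc\<close>, where \<open>u\<close> is a letter of the same tree
  and \<open>c\<close> was eliminated earlier. If \<open>z\<close> is the root or belongs to a later tree, then \<open>z\<close>, \<open>u\<close>, \<open>c\<close> are
  weakly decreasing. So an irreducible word never returns to the proper subtrees of the first tree
  once it has left them.
\<close>

lemma descent_into_subtree_reducible:
  assumes ordered: "ordered_forest ((y, C) # F)"
    and z: "z \<in> insert y (letters F)" and v: "v \<in> letters (subtrees y C)"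
  shows "reducible (p @ z @ v @ q)"
proof -
  obtain u c where u: "v = u @ c" "u \<in> tree y C" "c \<in> set C"
    using subtrees_split[OF v] by blast
  have C: "jordan_word y" "\<forall>c \<in> set C. jordan_word c" "\<forall>c \<in> set C. y \<ggreater> c"
    using ordered_forest_entry[OF ordered, of y C] by simp_all
  have "jordan_word u" using jordan_word_tree u C by blast
  obtain s where s: "u = y @ s" using tree_extends u by blast
  have "u \<ggreater> c" using s u C dominates_append1 by blast
  have "jordan_word z \<and> z \<ggreater> c \<and> z \<succeq> u"
  proof (cases "z = y")
    case True
    then show ?thesis using root_weakly_dominates_tree u C by blast
  next
    case False
    then obtain y' C' where y': "(y', C') \<in> set F" "z \<in> tree y' C'"
      using z by (auto simp: letters_def)
    have y'y: "y' \<ggreater> y" using ordered_forest_Cons_dominates[OF ordered y'(1)] .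
    have y'c: "y' \<ggreater> c" using ordered_forest_dominates[OF ordered _ _ u(3)] y'(1) by auto
    have "jordan_word z"
      using jordan_word_tree[OF y'(2)] ordered_forest_entry[OF ordered, of y' C'] y'(1) by simp
    moreover obtain s' where s': "z = y' @ s'" using tree_extends[OF y'(2)] by blast
    have "z \<ggreater> c" unfolding s' using y'c by (rule dominates_append1)
    moreover have "z \<ggreater> u" unfolding s' s using y'y by (rule dominates_append)
    ultimately show ?thesis
      using dominates_imp_weakly_dominates by simp
  qed
  moreover have "jordan_word c" using C u by blast
  ultimately have "reducible (p @ z @ u @ c @ q)"
    using \<open>jordan_word u\<close> \<open>u \<ggreater> c\<close> dominates_imp_weakly_dominates by (intro reducibleI) simp_all
  then show ?thesis using u(1) by simp
qed

lemma letters_dominate_root: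
  assumes "ordered_forest ((y, C) # F)" "z \<in> letters F"
  shows "jordan_word z" "z \<ggreater> y"
proof -
  obtain y' C' where y': "(y', C') \<in> set F" "z \<in> tree y' C'"
    using assms by (auto simp: letters_def)
  show "jordan_word z"
    using jordan_word_tree[OF y'(2)] ordered_forest_entry[OF assms(1), of y' C'] y'(1) by simp
  show "z \<ggreater> y"
    using tree_extends[OF y'(2)] ordered_forest_Cons_dominates[OF assms(1) y'(1)] dominates_append1 by blast
qed

lemma avoid_after_first:
  assumes "set ls \<subseteq> A \<union> B"
    and "\<And>us z v vs. ls = us @ z # v # vs \<Longrightarrow> z \<in> B \<Longrightarrow> v \<in> A \<Longrightarrow> False"
  shows "\<exists>us vs. ls = us @ vs \<and> set us \<subseteq> A \<and> set vs \<subseteq> B"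
  using assms
proof (induction ls rule: rev_induct)
  case (snoc x ls)
  have "\<exists>us vs. ls = us @ vs \<and> set us \<subseteq> A \<and> set vs \<subseteq> B"
  proof (rule snoc.IH)
    show "set ls \<subseteq> A \<union> B" using snoc.prems(1) by simp
    show False if "ls = us @ z # v # vs" "z \<in> B" "v \<in> A" for us z v vs
      using snoc.prems(2)[of us z v "vs @ [x]"] that by simp
  qed
  then obtain us vs where uv: "ls = us @ vs" "set us \<subseteq> A" "set vs \<subseteq> B"
    by blast
  show ?case
  proof (cases "x \<in> B")
    case True
    then show ?thesis using uv by (intro exI[of _ us] exI[of _ "vs @ [x]"]) auto
  next
    case False
    then have "x \<in> A" using snoc.prems(1) by auto
    have "vs = []"
    proof (rule ccontr)
      assume "vs \<noteq> []"
      then obtain vs' z where vs: "vs = vs' @ [z]" by (cases vs rule: rev_cases) auto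
      then show False
        using snoc.prems(2)[of "us @ vs'" z x "[]"] uv \<open>x \<in> A\<close> by simp
    qed
    then show ?thesis using uv \<open>x \<in> A\<close> by (intro exI[of _ "us @ [x]"] exI[of _ "[]"]) auto
  qed
qed simp

text \<open>
  Elimination of the root \<open>y\<close> of the first tree: every \<open>y\<close> is merged with the letter before it.
\<close>

lemma absorb_root:
  assumes "ordered_forest ((y, C) # F)" "set ls \<subseteq> insert y (letters F)" "\<not> reducible (concat ls)"
    and "ls = [] \<or> hd ls \<in> letters F"
  shows "\<exists>ms. concat ms = concat ls \<and> set ms \<subseteq> letters (graft y F) \<and> length ls \<le> 2 * length ms"
  using assms(2-)
proof (induction ls rule: length_induct)
  case (1 ls)
  show ?case
  proof (cases ls)
    case Nil
    then show ?thesis by (intro exI[of _ "[]"]) simp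
  next
    case (Cons z rest)
    then have z: "z \<in> letters F" "jordan_word z" "z \<ggreater> y"
      using 1 letters_dominate_root[OF assms(1)] by auto
    have sub: "\<exists>ms. concat ms = concat r \<and> set ms \<subseteq> letters (graft y F) \<and> length r \<le> 2 * length ms"
      if "rest = p @ r" "r = [] \<or> hd r \<in> letters F" for p r
    proof -
      have "\<not> reducible (concat r)"
        using 1(3) reducible_append[of "concat r" "z @ concat p" "[]"] that Cons by auto
      then show ?thesis using 1(1)[rule_format, of r] 1(2) that Cons by auto
    qed
    show ?thesis
    proof (cases "rest = [] \<or> hd rest \<in> letters F")
      case True
      then obtain ms where "concat ms = concat rest" "set ms \<subseteq> letters (graft y F)"
          "length rest \<le> 2 * length ms"
        using sub[of "[]" rest] by auto
      then show ?thesis using Cons z by (intro exI[of _ "z # ms"]) (auto simp: letters_graft)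
    next
      case False
      then obtain r where r: "rest = y # r"
        using 1(2) Cons by (cases rest) auto
      have "r = [] \<or> hd r \<in> letters F"
      proof (rule ccontr)
        assume "\<not> ?thesis"
        then obtain r' where "r = y # r'"
          using 1(2) Cons r by (cases r) auto
        then have "concat ls = [] @ z @ y @ y @ concat r'"
          using Cons r by simp
        moreover have "jordan_word y" using assms(1) by (simp add: ordered_forest_def)
        ultimately show False
          using 1(3) z(2) dominates_imp_weakly_dominates[OF z(3)] reducibleI weakly_dominates_refl by metis
      qed
      then obtain ms where "concat ms = concat r" "set ms \<subseteq> letters (graft y F)"
          "length r \<le> 2 * length ms"
        using sub[of "[y]" r] r by auto
      then show ?thesis using Cons z r by (intro exI[of _ "(z @ y) # ms"]) (auto simp: letters_graft)
    qed
  qed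
qed

text \<open>
  An irreducible word over the forest splits into a word over the proper subtrees of the first tree,
  at most two copies of its root, and a word in which the root can be absorbed into the letters of
  the other trees.
\<close>

lemma bounded_over_step:
  assumes ordered: "ordered_forest ((y, C) # F)"
    and "bounded_over (letters (subtrees y C))" "bounded_over (letters (graft y F))"
  shows "bounded_over (letters ((y, C) # F))"
proof -
  obtain b1 where b1: "\<And>ls. set ls \<subseteq> letters (subtrees y C) \<Longrightarrow> \<not> reducible (concat ls) \<Longrightarrow> length ls \<le> b1"
    using assms(2) by (auto simp: bounded_over_def)
  obtain b2 where b2: "\<And>ls. set ls \<subseteq> letters (graft y F) \<Longrightarrow> \<not> reducible (concat ls) \<Longrightarrow> length ls \<le> b2"
    using assms(3) by (auto simp: bounded_over_def)
  have y: "jordan_word y" using ordered by (simp add: ordered_forest_def)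
  have "length ls \<le> b1 + 2 + 2 * b2"
    if ls: "set ls \<subseteq> letters ((y, C) # F)" "\<not> reducible (concat ls)" for ls
  proof -
    have "\<exists>us vs. ls = us @ vs \<and> set us \<subseteq> letters (subtrees y C) \<and> set vs \<subseteq> insert y (letters F)"
    proof (rule avoid_after_first)
      show "set ls \<subseteq> letters (subtrees y C) \<union> insert y (letters F)"
        using ls(1) by (auto simp: tree_eq)
      show False if "ls = us @ z # v # vs" "z \<in> insert y (letters F)" "v \<in> letters (subtrees y C)"
        for us z v vs
        using descent_into_subtree_reducible[OF ordered that(2,3), of "concat us" "concat vs"] that ls(2)
        by simp
    qed
    then obtain us vs where uv: "ls = us @ vs" "set us \<subseteq> letters (subtrees y C)"
        "set vs \<subseteq> insert y (letters F)" by blast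
    define ws where "ws = dropWhile (\<lambda>l. l = y) vs"
    define n where "n = length (takeWhile (\<lambda>l. l = y) vs)"
    have "takeWhile (\<lambda>l. l = y) vs = replicate n y"
      unfolding n_def by (induction vs) auto
    then have vs: "vs = replicate n y @ ws"
      by (metis takeWhile_dropWhile_id ws_def)
    have "n \<le> 2"
    proof (rule ccontr)
      assume "\<not> n \<le> 2"
      then have "n = Suc (Suc (Suc (n - 3)))" by simp
      then have "replicate n y = y # y # y # replicate (n - 3) y"
        by (metis replicate_Suc)
      then have "concat ls = concat us @ y @ y @ y @ concat (replicate (n - 3) y @ ws)"
        using uv(1) vs by simp
      then show False
        using reducibleI[OF y y y] ls(2) weakly_dominates_refl by metis
    qed
    have ws: "ws = [] \<or> hd ws \<in> letters F"
      using uv(3) hd_dropWhile[of "\<lambda>l. l = y" vs] vs unfolding ws_def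
      by (metis Un_iff hd_in_set insertE set_append subsetD)
    have nred: "\<not> reducible (concat ws)" "\<not> reducible (concat us)"
      using ls(2) reducible_append[of "concat ws" "concat us @ concat (replicate n y)" "[]"]
        reducible_append[of "concat us" "[]" "concat vs"] uv(1) vs by auto
    obtain ms where "concat ms = concat ws" "set ms \<subseteq> letters (graft y F)" "length ws \<le> 2 * length ms"
      using absorb_root[OF ordered _ nred(1) ws] uv(3) vs by auto
    then have "length ws \<le> 2 * b2"
      using b2[of ms] nred(1) by simp
    moreover have "length us \<le> b1" using b1 uv(2) nred(2) by blast
    ultimately show ?thesis using uv(1) vs \<open>n \<le> 2\<close> by simp
  qed
  then show ?thesis unfolding bounded_over_def by blast
qed

text \<open>
  Induction on \<open>k\<close>, which decreases for the subtrees of the first tree, and for fixed \<open>k\<close> on the number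
  of trees, which decreases when the first root has been absorbed.
\<close>

lemma bounded_over_forest:
  "fits k F \<Longrightarrow> ordered_forest F \<Longrightarrow> bounded_over (letters F)"
proof (induction k arbitrary: F rule: less_induct)
  case (less k)
  from less.prems show ?case
  proof (induction "length F" arbitrary: F)
    case 0
    then show ?case by (auto simp: bounded_over_def)
  next
    case (Suc r)
    then obtain y C F' where F: "F = (y, C) # F'"
      by (cases F) auto
    then obtain l where l: "k = Suc l" "length C \<le> l" "fits l F'"
      using Suc.prems(1) by (cases k) auto
    have "bounded_over (letters (subtrees y C))"
    proof (rule less.IH[of "length C"])
      show "ordered_forest (subtrees y C)"
        using Suc.prems(2) F by (intro ordered_forest_subtrees) (auto simp: ordered_forest_def)
    qed (use l fits_subtrees in auto)
    moreover have "bounded_over (letters (graft y F'))"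
    proof (rule Suc.hyps(1))
      show "r = length (graft y F')" using Suc.hyps(2) F by (simp add: graft_def)
      show "fits k (graft y F')" using l fits_graft by blast
      show "ordered_forest (graft y F')" using Suc.prems(2) F ordered_forest_graft by blast
    qed
    ultimately show ?case using bounded_over_step Suc.prems(2) F by blast
  qed
qed

text \<open>
  The initial forest consists of the single letters, with nothing eliminated yet.
\<close>

theorem irreducible_words_bounded:
  "\<exists>b. \<forall>w. set w \<subseteq> {..<n} \<longrightarrow> \<not> reducible w \<longrightarrow> length w \<le> b"
proof -
  define F where "F = map (\<lambda>i. ([i], [] :: nat list list)) [0..<n]"
  have "fits (length xs) (map (\<lambda>i. ([i], [])) xs)" for xs
    by (induction xs) auto
  then have "fits (length [0..<n]) F" unfolding F_def .
  moreover have "ordered_forest F"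
    by (auto simp: ordered_forest_def F_def sorted_wrt_map intro: jordan_word.letter)
  ultimately have "bounded_over (letters F)" by (rule bounded_over_forest)
  then obtain b where b: "\<And>ls. set ls \<subseteq> letters F \<Longrightarrow> \<not> reducible (concat ls) \<Longrightarrow> length ls \<le> b"
    by (auto simp: bounded_over_def)
  have "length w \<le> b" if "set w \<subseteq> {..<n}" "\<not> reducible w" for w
  proof -
    have "concat (map (\<lambda>i. [i]) w) = w" by (induction w) auto
    moreover have "set (map (\<lambda>i. [i]) w) \<subseteq> letters F"
      using that(1) by (auto simp: F_def letters_def)
    ultimately show ?thesis using b[of "map (\<lambda>i. [i]) w"] that(2) by simp
  qed
  then show ?thesis by blast
qed

section \<open>Multiplication operators and their leading words\<close>

locale cube_zero_algebra = commutative_nonassoc_algebra scale mult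
  for scale :: "'k::field \<Rightarrow> 'a::ab_group_add \<Rightarrow> 'a" (infixr \<open>*s\<close> 75)
    and mult :: "'a \<Rightarrow> 'a \<Rightarrow> 'a" (infixl \<open>\<odot>\<close> 70) +
  assumes cube_zero: "x \<odot> x \<odot> x = 0"
    and two_neq_zero: "(2 :: 'k) \<noteq> 0"
    and three_neq_zero: "(3 :: 'k) \<noteq> 0"
begin

lemma additive_mult: "Modules.additive ((\<odot>) a)"
  by unfold_locales (rule mult_add_right)

lemma mult_zero_right [simp]: "a \<odot> 0 = 0"
  by (rule additive.zero[OF additive_mult])

lemma mult_minus_right: "a \<odot> (- x) = - (a \<odot> x)"
  by (rule additive.minus[OF additive_mult])

lemma mult_minus_left: "(- x) \<odot> a = - (x \<odot> a)"
  by (metis mult_commute mult_minus_right)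

lemma double_eq_zero: "(x :: 'a) + x = 0 \<Longrightarrow> x = 0"
  using scale_left_distrib[of 1 1 x] two_neq_zero by simp

lemma triple_eq_zero: "(x :: 'a) + x + x = 0 \<Longrightarrow> x = 0"
  using scale_left_distrib[of 2 1 x] scale_left_distrib[of 1 1 x] three_neq_zero by simp

text \<open>
  The part of \<open>(x + y)\<^sup>3\<close> that is linear in \<open>y\<close>, separated from the part quadratic in \<open>y\<close> by
  comparing \<open>y\<close> with \<open>- y\<close>.
\<close>

lemma square_mult: "(x \<odot> x) \<odot> y + ((x \<odot> y) \<odot> x + (x \<odot> y) \<odot> x) = 0"
proof -
  have *: "((x \<odot> x) \<odot> y + ((x \<odot> y) \<odot> x + (x \<odot> y) \<odot> x)) +
      ((y \<odot> y) \<odot> x + ((x \<odot> y) \<odot> y + (x \<odot> y) \<odot> y)) = 0" for x y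
  proof -
    have "(x + y) \<odot> (x + y) \<odot> (x + y) = x \<odot> x \<odot> x + y \<odot> y \<odot> y +
        (((x \<odot> x) \<odot> y + ((x \<odot> y) \<odot> x + (x \<odot> y) \<odot> x)) +
        ((y \<odot> y) \<odot> x + ((x \<odot> y) \<odot> y + (x \<odot> y) \<odot> y)))"
      by (simp add: mult_add_left mult_add_right mult_commute[of y x] algebra_simps)
    then show ?thesis by (simp add: cube_zero)
  qed
  have "((x \<odot> x) \<odot> y + ((x \<odot> y) \<odot> x + (x \<odot> y) \<odot> x)) +
      ((x \<odot> x) \<odot> y + ((x \<odot> y) \<odot> x + (x \<odot> y) \<odot> x)) = 0"
    using *[of x y] *[of x "- y"]
    by (simp add: mult_minus_left mult_minus_right algebra_simps)
  then show ?thesis by (rule double_eq_zero)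
qed

lemma jacobi: "(x \<odot> y) \<odot> z + x \<odot> (y \<odot> z) + y \<odot> (x \<odot> z) = 0"
proof -
  have "((x \<odot> y) \<odot> z + x \<odot> (y \<odot> z) + y \<odot> (x \<odot> z)) + ((x \<odot> y) \<odot> z + x \<odot> (y \<odot> z) + y \<odot> (x \<odot> z)) =
    ((x + y) \<odot> (x + y)) \<odot> z + (((x + y) \<odot> z) \<odot> (x + y) + ((x + y) \<odot> z) \<odot> (x + y))
    - ((x \<odot> x) \<odot> z + ((x \<odot> z) \<odot> x + (x \<odot> z) \<odot> x))
    - ((y \<odot> y) \<odot> z + ((y \<odot> z) \<odot> y + (y \<odot> z) \<odot> y))"
    by (simp add: mult_add_left mult_add_right mult_commute[of y x] mult_commute[of "x \<odot> z" y]
        mult_commute[of "y \<odot> z" x] algebra_simps)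
  also have "\<dots> = 0" unfolding square_mult by simp
  finally show ?thesis by (rule double_eq_zero)
qed

lemma mult_by_product: "(x \<odot> y) \<odot> z = - (x \<odot> (y \<odot> z)) - y \<odot> (x \<odot> z)"
  using jacobi[of x y z] by (simp add: eq_neg_iff_add_eq_0 algebra_simps)

text \<open>
  Let \<open>S\<close> be the sum. Expanding \<open>(ef)(gx)\<close> by the Jacobi identity as the operator of the product \<open>ef\<close>
  applied to \<open>gx\<close>, and summing over the cyclic permutations of \<open>e\<close>, \<open>f\<close>, \<open>g\<close>, gives \<open>- S\<close>. Expanding it
  as the operator of the product \<open>gx\<close> applied to \<open>ef\<close> gives \<open>S\<close> up to \<open>x\<close> times a Jacobi sum. Hence
  \<open>2 S = 0\<close>.
\<close>

lemma symmetrized_triple_zero: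
  "e \<odot> (f \<odot> (g \<odot> x)) + e \<odot> (g \<odot> (f \<odot> x)) + f \<odot> (e \<odot> (g \<odot> x)) + f \<odot> (g \<odot> (e \<odot> x)) +
   g \<odot> (e \<odot> (f \<odot> x)) + g \<odot> (f \<odot> (e \<odot> x)) = 0" (is "?S = 0")
proof -
  have 1: "(e \<odot> f) \<odot> (g \<odot> x) = - (e \<odot> (f \<odot> (g \<odot> x))) - f \<odot> (e \<odot> (g \<odot> x))" for e f g
    by (rule mult_by_product)
  have 2: "(e \<odot> f) \<odot> (g \<odot> x) = g \<odot> (e \<odot> (f \<odot> x)) + g \<odot> (f \<odot> (e \<odot> x)) - x \<odot> ((e \<odot> f) \<odot> g)" for e f g
    using mult_by_product[of g x "e \<odot> f"] mult_commute[of "g \<odot> x" "e \<odot> f"]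
      mult_commute[of x "e \<odot> f"] mult_commute[of g "e \<odot> f"]
      mult_by_product[of e f x] additive.diff[OF additive_mult] additive.minus[OF additive_mult]
    by (simp add: algebra_simps)
  have 3: "x \<odot> ((e \<odot> f) \<odot> g) = g \<odot> (e \<odot> (f \<odot> x)) + g \<odot> (f \<odot> (e \<odot> x)) +
      e \<odot> (f \<odot> (g \<odot> x)) + f \<odot> (e \<odot> (g \<odot> x))" for e f g
    using 1[of e f g] 2[of e f g] by (simp add: algebra_simps)
  have "(e \<odot> f) \<odot> g + (f \<odot> g) \<odot> e + (g \<odot> e) \<odot> f = 0"
    using jacobi[of e f g] by (simp add: mult_commute[of "f \<odot> g" e] mult_commute[of g e] mult_commute[of "e \<odot> g" f] ac_simps)
  then have "x \<odot> ((e \<odot> f) \<odot> g) + x \<odot> ((f \<odot> g) \<odot> e) + x \<odot> ((g \<odot> e) \<odot> f) = 0"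
    by (metis mult_add_right mult_zero_right)
  moreover have "?S + ?S = x \<odot> ((e \<odot> f) \<odot> g) + x \<odot> ((f \<odot> g) \<odot> e) + x \<odot> ((g \<odot> e) \<odot> f)"
    unfolding 3[of e f g] 3[of f g e] 3[of g e f] by (simp add: algebra_simps)
  ultimately show ?thesis by (metis double_eq_zero)
qed

definition act :: "('b \<Rightarrow> 'a) \<Rightarrow> 'b list \<Rightarrow> 'a \<Rightarrow> 'a" where
  "act a w = foldr (\<lambda>i. (\<odot>) (a i)) w"

lemma act_simps [simp]:
  "act a [] x = x" "act a (i # w) x = a i \<odot> act a w x" "act a (u @ w) x = act a u (act a w x)"
  by (simp_all add: act_def)

lemma additive_act: "Modules.additive (act a w)"
  by (induction w) (unfold_locales, auto simp: mult_add_right additive.add)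

lemma act_zero [simp]: "act a w 0 = 0"
  by (rule additive.zero[OF additive_act])

lemma additive_comp:
  "Modules.additive g \<Longrightarrow> Modules.additive h \<Longrightarrow> Modules.additive (\<lambda>x. g (h x))"
  by (simp add: Modules.additive_def)

definition below :: "nat list \<Rightarrow> nat list set" where
  "below w = {w'. length w' = length w \<and> set w' \<subseteq> set w \<and> w \<ggreater> w'}"

lemma below_append:
  "u' \<in> below u \<Longrightarrow> length v' = length v \<Longrightarrow> set v' \<subseteq> set v \<Longrightarrow> u' @ v' \<in> below (u @ v)"
  by (auto simp: below_def dominates_append)

lemma below_prepend: "v' \<in> below v \<Longrightarrow> u @ v' \<in> below (u @ v)"
  by (auto simp: below_def dominates_prepend)

lemma below_trans: "u \<in> below v \<Longrightarrow> v \<in> below w \<Longrightarrow> u \<in> below w"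
  using dominates_trans by (auto simp: below_def)

text \<open>
  The operator \<open>T\<close> is the word \<open>u\<close> plus a combination of smaller words. Rather than by
  spans in a space of operators, this is expressed by its effect in a context: when \<open>h\<close> and \<open>x\<close>
  annihilate all smaller words, they cannot distinguish \<open>T\<close> from \<open>u\<close>.
\<close>

definition leads :: "(nat \<Rightarrow> 'a) \<Rightarrow> nat list \<Rightarrow> ('a \<Rightarrow> 'a) \<Rightarrow> bool" where
  "leads a u T \<longleftrightarrow> (\<forall>h :: 'a \<Rightarrow> 'a. \<forall>x. Modules.additive h \<longrightarrow>
     (\<forall>u' \<in> below u. h (act a u' x) = 0) \<longrightarrow> h (T x) = h (act a u x))"

lemma leadsD:
  "leads a u T \<Longrightarrow> Modules.additive (h :: 'a \<Rightarrow> 'a) \<Longrightarrow> (\<And>u'. u' \<in> below u \<Longrightarrow> h (act a u' x) = 0) \<Longrightarrow>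
   h (T x) = h (act a u x)"
  unfolding leads_def by blast

lemma leads_below_zero:
  assumes "leads a u T" "u \<in> below w" "Modules.additive (h :: 'a \<Rightarrow> 'a)" "\<And>w'. w' \<in> below w \<Longrightarrow> h (act a w' x) = 0"
  shows "h (T x) = 0"
  using leadsD[OF assms(1,3), of x] assms(2,4) below_trans by metis

lemma leads_comp:
  assumes u: "leads a u T" and v: "leads a v T'"
  shows "leads a (u @ v) (\<lambda>x. T (T' x))"
  unfolding leads_def
proof (intro allI impI)
  fix h :: "'a \<Rightarrow> 'a" and x
  assume h: "Modules.additive h" and low: "\<forall>w' \<in> below (u @ v). h (act a w' x) = 0"
  have T': "h (act a u' (T' x)) = h (act a u' (act a v x))"
    if "u' = u \<or> u' \<in> below u" for u'
  proof (rule leadsD[OF v, where h = "\<lambda>y. h (act a u' y)"])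
    show "Modules.additive (\<lambda>y. h (act a u' y))"
      using h additive_act by (rule additive_comp)
    fix v' assume "v' \<in> below v"
    then have "u' @ v' \<in> below (u @ v)"
      using that below_append[of u' u v' v] below_prepend by (auto simp: below_def)
    then show "h (act a u' (act a v' x)) = 0" using low by fastforce
  qed
  have "h (T (T' x)) = h (act a u (T' x))"
  proof (rule leadsD[OF u h])
    fix u' assume "u' \<in> below u"
    then have "u' @ v \<in> below (u @ v)" by (simp add: below_append)
    then show "h (act a u' (T' x)) = 0"
      using T'[of u'] \<open>u' \<in> below u\<close> low by fastforce
  qed
  then show "h (T (T' x)) = h (act a (u @ v) x)" using T'[of u] by simp
qed

lemma leads_product:
  assumes u: "leads a u ((\<odot>) e)" and v: "leads a v ((\<odot>) f)" and uv: "u \<ggreater> v"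
  shows "leads a (u @ v) ((\<odot>) (- (e \<odot> f)))"
  unfolding leads_def
proof (intro allI impI)
  fix h :: "'a \<Rightarrow> 'a" and x
  assume h: "Modules.additive h" and low: "\<forall>w' \<in> below (u @ v). h (act a w' x) = 0"
  have "v @ u \<in> below (u @ v)" using uv by (auto simp: below_def dominates_append)
  then have "h (f \<odot> (e \<odot> x)) = 0"
    using leads_below_zero[OF leads_comp[OF v u] _ h] low by blast
  moreover have "h (e \<odot> (f \<odot> x)) = h (act a (u @ v) x)"
    using leadsD[OF leads_comp[OF u v] h] low by blast
  moreover have "- (e \<odot> f) \<odot> x = e \<odot> (f \<odot> x) + f \<odot> (e \<odot> x)"
    by (simp add: mult_minus_left mult_by_product)
  ultimately show "h (- (e \<odot> f) \<odot> x) = h (act a (u @ v) x)"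
    using additive.add[OF h] by simp
qed

text \<open>
  The purpose of Jordan words: each of them is the leading word of the operator of one element.
\<close>

lemma jordan_word_leads: "jordan_word u \<Longrightarrow> \<exists>e. leads a u ((\<odot>) e)"
proof (induction rule: jordan_word.induct)
  case (letter i)
  show ?case by (rule exI[of _ "a i"]) (simp add: leads_def)
next
  case (product u v)
  then show ?case using leads_product by blast
qed

text \<open>
  Apply \<open>symmetrized_triple_zero\<close> to elements with the leading words \<open>x\<close>, \<open>y\<close>, \<open>z\<close>. The arrangements
  different from \<open>xyz\<close> are smaller and vanish, so what remains is a multiple of the word itself; the
  factor is \<open>6\<close>, \<open>2\<close> or \<open>1\<close>, depending on which of \<open>x\<close>, \<open>y\<close>, \<open>z\<close> coincide.
\<close>

lemma reducible_act_zero: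
  assumes "reducible w" and low: "\<And>w' x. w' \<in> below w \<Longrightarrow> act a w' x = 0"
  shows "act a w s = 0"
proof -
  obtain p x y z q where w: "w = p @ x @ y @ z @ q"
    and jw: "jordan_word x" "jordan_word y" "jordan_word z"
    and prec: "x \<succeq> y" "y \<succeq> z" "x \<succeq> z"
    using assms(1) unfolding reducible_def by blast
  define h t where "h = act a p" and "t = act a q s"
  have h: "Modules.additive h" unfolding h_def by (rule additive_act)
  have low': "h (act a w' t) = 0" if "w' \<in> below (x @ y @ z)" for w'
  proof -
    have "p @ w' @ q \<in> below w"
      unfolding w using that below_prepend[of "w' @ q" "x @ y @ z @ q" p]
        below_append[of w' "x @ y @ z" q q] by simp
    then show ?thesis using low unfolding h_def t_def by fastforce
  qed
  have "\<exists>E. \<forall>u. jordan_word u \<longrightarrow> leads a u ((\<odot>) (E u))"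
    using jordan_word_leads by (intro choice) blast
  then obtain E where E: "\<And>u. jordan_word u \<Longrightarrow> leads a u ((\<odot>) (E u))"
    by blast
  define T where "T u1 u2 u3 = h (E u1 \<odot> (E u2 \<odot> (E u3 \<odot> t)))" for u1 u2 u3
  have lead: "leads a (u1 @ u2 @ u3) (\<lambda>s. E u1 \<odot> (E u2 \<odot> (E u3 \<odot> s)))"
    if "{u1, u2, u3} \<subseteq> {x, y, z}" for u1 u2 u3
  proof -
    have "jordan_word u1" "jordan_word u2" "jordan_word u3" using that jw by auto
    then show ?thesis by (intro leads_comp[of a _ "(\<odot>) (E u1)"] leads_comp E)
  qed
  have top: "T x y z = act a w s"
    using leadsD[OF lead[of x y z] h, of t] low' unfolding T_def by (simp add: w h_def t_def)
  have vanish: "T u1 u2 u3 = 0"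
    if "{u1, u2, u3} = {x, y, z}" "length (u1 @ u2 @ u3) = length (x @ y @ z)"
      "x @ y @ z \<ggreater> u1 @ u2 @ u3" for u1 u2 u3
  proof -
    have "set u1 \<union> set u2 \<union> set u3 = \<Union> (set ` {u1, u2, u3})" by auto
    also have "\<dots> = \<Union> (set ` {x, y, z})" unfolding that(1) ..
    finally have "u1 @ u2 @ u3 \<in> below (x @ y @ z)"
      using that(2,3) by (auto simp: below_def)
    then show ?thesis
      unfolding T_def by (intro leads_below_zero[OF lead _ h low']) (use that(1) in auto)
  qed
  have six: "T x y z + T x z y + T y x z + T y z x + T z x y + T z y x = 0"
    using symmetrized_triple_zero[of "E x" "E y" "E z" t] additive.zero[OF h]
    unfolding T_def additive.add[OF h, symmetric] by simp
  have xy: "x @ y @ r \<ggreater> y @ x @ r'" if "x \<noteq> y" for r r'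
    using prec(1) that dominates_append[of "x @ y" "y @ x" r r'] by (simp add: weakly_dominates_def)
  have yz: "y @ z @ r \<ggreater> z @ y @ r'" if "y \<noteq> z" for r r'
    using prec(2) that dominates_append[of "y @ z" "z @ y" r r'] by (simp add: weakly_dominates_def)
  have xz: "x @ z @ r \<ggreater> z @ x @ r'" if "x \<noteq> z" for r r'
    using prec(3) that dominates_append[of "x @ z" "z @ x" r r'] by (simp add: weakly_dominates_def)
  have "T x y z = 0"
  proof (cases "x = y"; cases "y = z")
    assume eq: "x = y" "y = z"
    let ?t = "T x y z"
    have "(?t + ?t + ?t) + (?t + ?t + ?t) = 0" using six eq by (simp add: ac_simps)
    then show ?thesis using double_eq_zero triple_eq_zero by blast
  next
    assume eq: "x = y" and neq: "y \<noteq> z"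
    have "y @ y @ z \<ggreater> y @ z @ y" "y @ z @ y \<ggreater> z @ y @ y"
      using yz[OF neq, of "[]" "[]"] yz[OF neq, of y y] dominates_prepend[of y "y @ z" "z @ y"] by auto
    then have "T y z y = 0" "T z y y = 0"
      using vanish[of y z y] vanish[of z y y] eq dominates_trans[of "y @ y @ z"] by auto
    then have "T x y z + T x y z = 0" using six eq by simp
    then show ?thesis by (rule double_eq_zero)
  next
    assume neq: "x \<noteq> y" and eq: "y = z"
    have "x @ y @ y \<ggreater> y @ x @ y" "y @ x @ y \<ggreater> y @ y @ x"
      using xy[OF neq, of "[]" "[]"] xy[OF neq, of y y] dominates_prepend[of y "x @ y" "y @ x"] by auto
    then have "T y x y = 0" "T y y x = 0"
      using vanish[of y x y] vanish[of y y x] eq dominates_trans[of "x @ y @ y"] by auto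
    then have "T x y z + T x y z = 0" using six eq by simp
    then show ?thesis by (rule double_eq_zero)
  next
    assume neq: "x \<noteq> y" "y \<noteq> z"
    have "x \<noteq> z"
      \<comment> \<open>otherwise \<open>xy\<close> and \<open>yx\<close> would dominate each other\<close>
      using xy[OF neq(1), of "[]" "[]"] yz[OF neq(2), of "[]" "[]"] dominates_trans dominates_irrefl by auto
    have yxz: "x @ y @ z \<ggreater> y @ x @ z" using xy neq by blast
    have yzx: "x @ y @ z \<ggreater> y @ z @ x"
      using yxz xz[OF \<open>x \<noteq> z\<close>, of "[]" "[]"] dominates_prepend[of y "x @ z" "z @ x"] dominates_trans by auto
    have zyx: "x @ y @ z \<ggreater> z @ y @ x"
      using yzx yz[OF neq(2), of x x] dominates_trans by blast
    have xzy: "x @ y @ z \<ggreater> x @ z @ y"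
      using yz[OF neq(2), of "[]" "[]"] dominates_prepend[of x "y @ z" "z @ y"] by auto
    have zxy: "x @ y @ z \<ggreater> z @ x @ y"
      using xzy xz[OF \<open>x \<noteq> z\<close>, of y y] dominates_trans by blast
    have "T y x z = 0" "T y z x = 0" "T z y x = 0" "T x z y = 0" "T z x y = 0"
      using vanish[OF _ _ yxz] vanish[OF _ _ yzx] vanish[OF _ _ zyx] vanish[OF _ _ xzy] vanish[OF _ _ zxy]
      by auto
    then show ?thesis using six by simp
  qed
  then show ?thesis using top by simp
qed

theorem finitely_many_multiplications_nilpotent:
  assumes "finite X"
  shows "\<exists>L. \<forall>ws x. set ws \<subseteq> X \<longrightarrow> length ws = L \<longrightarrow> act id ws x = 0"
proof -
  obtain n and a :: "nat \<Rightarrow> 'a" where X: "X = a ` {..<n}"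
    using assms unfolding finite_conv_nat_seg_image lessThan_def by blast
  obtain b where b: "\<And>w. set w \<subseteq> {..<n} \<Longrightarrow> \<not> reducible w \<Longrightarrow> length w \<le> b"
    using irreducible_words_bounded by blast
  have zero: "set w \<subseteq> {..<n} \<Longrightarrow> length w = Suc b \<Longrightarrow> act a w x = 0" for w x
  proof (induction w arbitrary: x rule: wf_induct[OF wf_lex[OF wf_less_than]])
    case (1 w)
    have "reducible w" using b[of w] 1(2,3) by auto
    then show ?case
    proof (rule reducible_act_zero)
      fix w' x assume "w' \<in> below w"
      then have "(w', w) \<in> lex less_than" "set w' \<subseteq> {..<n}" "length w' = Suc b"
        using 1(2,3) dominates_imp_lex by (auto simp: below_def)
      then show "act a w' x = 0" using 1(1) by blast
    qed
  qed
  have "act id ws x = 0" if "set ws \<subseteq> X" "length ws = Suc b" for ws x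
  proof -
    define r where "r = inv_into {..<n} a"
    have r: "r s \<in> {..<n}" "a (r s) = s" if "s \<in> X" for s
      using that inv_into_into[of s a "{..<n}"] f_inv_into_f[of s a "{..<n}"] unfolding r_def X by blast+
    have "set (map r ws) \<subseteq> {..<n}" using r(1) that(1) by auto
    moreover have "act a (map r ws) x = act id ws x"
      using that(1) by (induction ws) (simp_all add: r(2))
    ultimately show ?thesis
      using zero[of "map r ws" x] that(2) by simp
  qed
  then show ?thesis by blast
qed

section \<open>Consequences of the ascending chain condition\<close>

lemma maximal_ideal_of_family:
  assumes acc: acc_on_ideals and ideals: "\<And>I. I \<in> \<F> \<Longrightarrow> alg_ideal I" and "I0 \<in> \<F>"
  shows "\<exists>M \<in> \<F>. \<forall>J \<in> \<F>. M \<subseteq> J \<longrightarrow> J = M"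
proof (rule ccontr)
  assume "\<not> ?thesis"
  then have step: "\<exists>J. J \<in> \<F> \<and> M \<subset> J" if "M \<in> \<F>" for M using that by blast
  have "\<exists>I :: nat \<Rightarrow> 'a set. \<forall>n. I n \<in> \<F> \<and> I n \<subset> I (Suc n)"
    using dependent_nat_choice[of "\<lambda>_ I. I \<in> \<F>" "\<lambda>_. (\<subset>)"] assms(3) step by blast
  then obtain I :: "nat \<Rightarrow> 'a set" where I: "\<And>n. I n \<in> \<F>" "\<And>n. I n \<subset> I (Suc n)" by blast
  have "\<exists>m. \<forall>n\<ge>m. I n = I m"
    using acc I ideals unfolding acc_on_ideals_def by (simp add: psubset_imp_subset)
  then obtain m where "I (Suc m) = I m" by (meson le_SucI order_refl)
  then show False using I(2)[of m] by simp
qed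

lemma act_scale: "act a w (c *s x) = c *s act a w x"
  by (induction w) (simp_all add: mult_scale_right)

lemma span_act_into:
  assumes "x \<in> span A" "subspace S" "\<And>x. x \<in> A \<Longrightarrow> act a w x \<in> S"
  shows "act a w x \<in> S"
proof -
  have "subspace {x. act a w x \<in> S}"
    using assms(2) by (simp add: subspace_def additive.add[OF additive_act] act_scale)
  then have "x \<in> {x. act a w x \<in> S}"
    using assms(1,3) span_minimal[of A "{x. act a w x \<in> S}"] by blast
  then show ?thesis by simp
qed

lemma span_mult_into:
  assumes "x \<in> span A" "subspace S" "\<And>x. x \<in> A \<Longrightarrow> a \<odot> x \<in> S"
  shows "a \<odot> x \<in> S"
  using span_act_into[of x A S id "[a]"] assms by simp

primrec lower_central :: "nat \<Rightarrow> 'a set" where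
  "lower_central 0 = UNIV"
| "lower_central (Suc k) = span {x \<odot> y | x y. y \<in> lower_central k}"

lemma subspace_lower_central: "subspace (lower_central k)"
  by (cases k) auto

lemma mult_lower_central: "y \<in> lower_central k \<Longrightarrow> x \<odot> y \<in> lower_central (Suc k)"
  by (auto intro: span_base)

lemma lower_central_decreasing: "lower_central (Suc k) \<subseteq> lower_central k"
proof (induction k)
  case (Suc k)
  then show ?case by (subst (1 2) lower_central.simps) (intro span_mono, blast)
qed simp

lemma alg_ideal_lower_central: "alg_ideal (lower_central k)"
  unfolding alg_ideal_def
  using subspace_lower_central mult_lower_central lower_central_decreasing mult_commute
  by (metis subsetD)

lemma act_lower_central: "act a w x \<in> lower_central (length w)"
  by (induction w) (simp_all only: act_simps list.size add_0_right One_nat_def add_Suc_right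
      mult_lower_central lower_central.simps(1) UNIV_I)

text \<open>
  The operator of a product is a combination of products of two operators, so it moves two steps
  down the series.
\<close>

lemma lower_central_1_mult:
  assumes "t \<in> lower_central 1" "y \<in> lower_central k"
  shows "t \<odot> y \<in> lower_central (Suc (Suc k))"
proof -
  have "y \<odot> t \<in> lower_central (Suc (Suc k))"
  proof (rule span_mult_into)
    show "t \<in> span {u \<odot> v | u v. True}" using assms(1) by simp
    show "subspace (lower_central (Suc (Suc k)))" by (rule subspace_lower_central)
    fix s assume "s \<in> {u \<odot> v | u v. True}"
    then obtain u v where s: "s = u \<odot> v" by blast
    have "u \<odot> (v \<odot> y) \<in> lower_central (Suc (Suc k))" "v \<odot> (u \<odot> y) \<in> lower_central (Suc (Suc k))"
      using assms(2) mult_lower_central by blast+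
    then have "- (u \<odot> (v \<odot> y)) - v \<odot> (u \<odot> y) \<in> lower_central (Suc (Suc k))"
      using subspace_lower_central subspace_neg subspace_diff by blast
    then show "y \<odot> s \<in> lower_central (Suc (Suc k))"
      unfolding s mult_commute[of y] mult_by_product .
  qed
  then show ?thesis by (simp only: mult_commute[of t])
qed

definition monomials :: "'a set \<Rightarrow> nat \<Rightarrow> 'a set" where
  "monomials X k = {act id ws x | ws x. set ws \<subseteq> X \<and> length ws = k \<and> x \<in> X}"

lemma finite_monomials: "finite X \<Longrightarrow> finite (monomials X k)"
proof -
  assume "finite X"
  then have "finite ((\<lambda>(ws, x). act id ws x) ` ({ws. set ws \<subseteq> X \<and> length ws = k} \<times> X))"
    using finite_lists_length_eq by blast
  moreover have "monomials X k = (\<lambda>(ws, x). act id ws x) ` ({ws. set ws \<subseteq> X \<and> length ws = k} \<times> X)"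
    unfolding monomials_def by force
  ultimately show ?thesis by simp
qed

text \<open>
  Replacing both factors of a product by representatives modulo the next term of the series changes
  the product only by terms further down; for the left factor this is \<open>lower_central_1_mult\<close>.
\<close>

lemma lower_central_subset_span:
  assumes X: "span (X \<union> lower_central 1) = UNIV"
  shows "lower_central k \<subseteq> span (monomials X k \<union> lower_central (Suc k))"
proof (induction k)
  case 0
  have "X \<subseteq> monomials X 0" by (force simp: monomials_def)
  then have "span (X \<union> lower_central 1) \<subseteq> span (monomials X 0 \<union> lower_central (Suc 0))"
    by (intro span_mono) auto
  then show ?case using X by simp
next
  case (Suc k)
  let ?S = "span (monomials X (Suc k) \<union> lower_central (Suc (Suc k)))"
  have lc: "lower_central (Suc (Suc k)) \<subseteq> ?S"
    using span_superset by blast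
  have "x \<odot> y \<in> ?S" if "y \<in> lower_central k" for x y
  proof (rule span_mult_into)
    show "y \<in> span (monomials X k \<union> lower_central (Suc k))" using Suc that by blast
    show "subspace ?S" by simp
    fix y assume y: "y \<in> monomials X k \<union> lower_central (Suc k)"
    show "x \<odot> y \<in> ?S"
    proof (cases "y \<in> lower_central (Suc k)")
      case True
      then show ?thesis using mult_lower_central lc by blast
    next
      case False
      then have y: "y \<in> monomials X k" using y by blast
      have "y \<odot> x \<in> ?S"
      proof (rule span_mult_into)
        show "x \<in> span (X \<union> lower_central 1)" using X by simp
        show "subspace ?S" by simp
        fix x assume "x \<in> X \<union> lower_central 1"
        then have "x \<odot> y \<in> ?S"
        proof
          assume "x \<in> X"
          obtain ws z where ws: "y = act id ws z" "set ws \<subseteq> X" "length ws = k" "z \<in> X"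
            using y unfolding monomials_def by blast
          have "x \<odot> y = act id (x # ws) z" "set (x # ws) \<subseteq> X" "length (x # ws) = Suc k"
            using ws \<open>x \<in> X\<close> by simp_all
          then have "x \<odot> y \<in> monomials X (Suc k)"
            unfolding monomials_def using ws(4) by blast
          then show ?thesis using span_superset by blast
        next
          assume "x \<in> lower_central 1"
          moreover have "y \<in> lower_central k"
            using y act_lower_central unfolding monomials_def by blast
          ultimately show ?thesis using lower_central_1_mult lc by blast
        qed
        then show "y \<odot> x \<in> ?S" by (simp only: mult_commute)
      qed
      then show ?thesis by (simp only: mult_commute)
    qed
  qed
  then show ?case
    by (subst lower_central.simps) (intro span_minimal, auto)
qed

text \<open>
  For \<open>Y = UNIV\<close> and \<open>k = 0\<close> this is the ideal generated by \<open>G\<close>. The general form records which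
  multipliers, and how many of them, are used to reach an element.
\<close>

definition word_span :: "'a set \<Rightarrow> nat \<Rightarrow> 'a set \<Rightarrow> 'a set" where
  "word_span Y k G = span {act id ws g | ws g. g \<in> G \<and> set ws \<subseteq> Y \<and> k \<le> length ws}"

lemma subspace_word_span: "subspace (word_span Y k G)"
  by (simp add: word_span_def)

lemma word_span_base:
  "g \<in> G \<Longrightarrow> set ws \<subseteq> Y \<Longrightarrow> k \<le> length ws \<Longrightarrow> act id ws g \<in> word_span Y k G"
  unfolding word_span_def by (rule span_base) blast

lemma word_span_mono: "Y \<subseteq> Y' \<Longrightarrow> G \<subseteq> G' \<Longrightarrow> word_span Y k G \<subseteq> word_span Y' k G'"
  unfolding word_span_def by (rule span_mono) blast

lemma mult_word_span: "x \<in> word_span Y k G \<Longrightarrow> y \<in> Y \<Longrightarrow> y \<odot> x \<in> word_span Y (Suc k) G"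
proof (rule span_mult_into)
  assume "x \<in> word_span Y k G"
  then show "x \<in> span {act id ws g | ws g. g \<in> G \<and> set ws \<subseteq> Y \<and> k \<le> length ws}"
    by (simp add: word_span_def)
next
  fix x assume "y \<in> Y" "x \<in> {act id ws g | ws g. g \<in> G \<and> set ws \<subseteq> Y \<and> k \<le> length ws}"
  then obtain ws g where "x = act id ws g" "g \<in> G" "set (y # ws) \<subseteq> Y" "Suc k \<le> length (y # ws)"
    by auto
  then show "y \<odot> x \<in> word_span Y (Suc k) G"
    using word_span_base[of g G "y # ws"] by simp
qed (rule subspace_word_span)

lemma word_span_Suc_subset: "word_span Y (Suc k) G \<subseteq> word_span Y k G"
  unfolding word_span_def by (rule span_mono) (blast dest: Suc_leD)

lemma alg_ideal_word_span: "alg_ideal (word_span UNIV 0 G)"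
  unfolding alg_ideal_def
  using subspace_word_span mult_word_span[of _ UNIV 0 G] word_span_Suc_subset[of UNIV 0 G] mult_commute
  by (metis UNIV_I subsetD)

lemma word_span_subset_ideal:
  assumes "alg_ideal I" "G \<subseteq> I"
  shows "word_span UNIV 0 G \<subseteq> I"
  unfolding word_span_def
proof (rule span_minimal)
  have "act id ws g \<in> I" if "g \<in> G" for ws g
    using that assms by (induction ws) (auto simp: alg_ideal_def)
  then show "{act id ws g | ws g. g \<in> G \<and> set ws \<subseteq> UNIV \<and> 0 \<le> length ws} \<subseteq> I" by blast
  show "subspace I" using assms(1) by (simp add: alg_ideal_def)
qed

lemma ideal_finitely_generated:
  assumes acc_on_ideals "alg_ideal I"
  shows "\<exists>G. finite G \<and> G \<subseteq> I \<and> I = word_span UNIV 0 G"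
proof -
  let ?\<F> = "{word_span UNIV 0 G | G. finite G \<and> G \<subseteq> I}"
  have "word_span UNIV 0 {} \<in> ?\<F>" by blast
  then have "\<exists>M \<in> ?\<F>. \<forall>J \<in> ?\<F>. M \<subseteq> J \<longrightarrow> J = M"
    by (rule maximal_ideal_of_family[OF assms(1), rotated]) (auto simp: alg_ideal_word_span)
  then obtain G where G: "finite G" "G \<subseteq> I"
    and max: "\<And>J. J \<in> ?\<F> \<Longrightarrow> word_span UNIV 0 G \<subseteq> J \<Longrightarrow> J = word_span UNIV 0 G"
    by auto
  have "x \<in> word_span UNIV 0 G" if "x \<in> I" for x
  proof -
    have "word_span UNIV 0 (insert x G) \<in> ?\<F>" using G that by blast
    then have "word_span UNIV 0 (insert x G) = word_span UNIV 0 G"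
      using max word_span_mono[of UNIV UNIV G "insert x G"] by blast
    moreover have "x \<in> word_span UNIV 0 (insert x G)"
      using word_span_base[of x "insert x G" "[]"] by simp
    ultimately show ?thesis by simp
  qed
  then show ?thesis using G word_span_subset_ideal[OF assms(2) G(2)] by blast
qed

lemma word_span_finite_support:
  assumes "x \<in> word_span UNIV k G"
  shows "\<exists>Y. finite Y \<and> x \<in> word_span Y k G"
  using assms unfolding word_span_def[of UNIV]
proof (induction rule: span_induct_alt)
  case base
  show ?case using subspace_0[OF subspace_word_span] by blast
next
  case (step c p y)
  then obtain ws g where p: "p = act id ws g" "g \<in> G" "k \<le> length ws" by blast
  obtain Y where Y: "finite Y" "y \<in> word_span Y k G" using step by blast
  have "p \<in> word_span (Y \<union> set ws) k G" unfolding p(1) using p by (intro word_span_base) auto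
  moreover have "y \<in> word_span (Y \<union> set ws) k G"
    using Y(2) word_span_mono[of Y "Y \<union> set ws" G G] by blast
  ultimately have "c *s p + y \<in> word_span (Y \<union> set ws) k G"
    using subspace_word_span subspace_add subspace_scale by blast
  then show ?case using Y(1) by (intro exI[of _ "Y \<union> set ws"]) simp
qed

text \<open>
  Nakayama's argument. From \<open>I = N I\<close>, each of finitely many generators is a combination of
  generators multiplied by at least one element, taken from a fixed finite set \<open>Z\<close>. Iterating, the
  generators lie in the span of arbitrarily long words in \<open>Z\<close> applied to generators, and such
  words vanish.
\<close>

lemma idempotent_ideal_zero:
  assumes acc: acc_on_ideals and I: "alg_ideal I" and idem: "I \<subseteq> span {x \<odot> y | x y. y \<in> I}"
  shows "I \<subseteq> {0}"
proof -
  obtain G where G: "finite G" "G \<subseteq> I" "I = word_span UNIV 0 G"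
    using ideal_finitely_generated[OF acc I] by blast
  have "span {x \<odot> y | x y. y \<in> I} \<subseteq> word_span UNIV 1 G"
  proof (rule span_minimal)
    show "{x \<odot> y | x y. y \<in> I} \<subseteq> word_span UNIV 1 G"
      unfolding G(3) using mult_word_span[of _ UNIV 0 G] by auto
  qed (rule subspace_word_span)
  then have "\<forall>g \<in> G. \<exists>Y. finite Y \<and> g \<in> word_span Y 1 G"
    using idem G(2) word_span_finite_support by blast
  then obtain Y where Y: "\<And>g. g \<in> G \<Longrightarrow> finite (Y g) \<and> g \<in> word_span (Y g) 1 G"
    by metis
  define Z where "Z = (\<Union>g \<in> G. Y g)"
  have "finite Z" using Y G(1) by (simp add: Z_def)
  have Z1: "g \<in> word_span Z 1 G" if "g \<in> G" for g
    using Y[OF that] word_span_mono[of "Y g" Z G G 1] that unfolding Z_def by blast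
  have shift: "act id ws x \<in> word_span Z (length ws + k) G"
    if "x \<in> word_span Z k G" "set ws \<subseteq> Z" for ws x k
    using that by (induction ws) (auto intro: mult_word_span)
  have Zk: "G \<subseteq> word_span Z k G" for k
  proof (induction k)
    case 0
    show ?case using word_span_base[of _ G "[]" Z 0] by auto
  next
    case (Suc k)
    have "word_span Z 1 G \<subseteq> word_span Z (Suc k) G"
      unfolding word_span_def[of Z 1]
    proof (rule span_minimal)
      show "{act id ws g | ws g. g \<in> G \<and> set ws \<subseteq> Z \<and> 1 \<le> length ws} \<subseteq> word_span Z (Suc k) G"
      proof clarify
        fix ws g assume *: "g \<in> G" "set ws \<subseteq> Z" "1 \<le> length ws"
        then obtain y vs where ws: "ws = y # vs" by (cases ws) auto
        have "act id vs g \<in> word_span Z (length vs + k) G"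
          using shift[of g k vs] Suc * ws by auto
        moreover have "word_span Z (length vs + k) G \<subseteq> word_span Z k G"
          unfolding word_span_def by (rule span_mono) fastforce
        ultimately show "act id ws g \<in> word_span Z (Suc k) G"
          using mult_word_span[of "act id vs g" Z k G y] * ws by auto
      qed
    qed (rule subspace_word_span)
    then show ?case using Z1 by blast
  qed
  obtain L where L: "\<And>ws x. set ws \<subseteq> Z \<Longrightarrow> length ws = L \<Longrightarrow> act id ws x = 0"
    using finitely_many_multiplications_nilpotent[OF \<open>finite Z\<close>] by blast
  have "word_span Z L G \<subseteq> {0}"
    unfolding word_span_def
  proof (rule span_minimal)
    show "{act id ws g | ws g. g \<in> G \<and> set ws \<subseteq> Z \<and> L \<le> length ws} \<subseteq> {0}"
    proof clarify
      fix ws g assume "set ws \<subseteq> Z" "L \<le> length ws"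
      then have "act id (take L ws) (act id (drop L ws) g) = 0"
        using set_take_subset[of L ws] by (intro L) auto
      then show "act id ws g = 0"
        by (simp only: act_simps(3)[symmetric] append_take_drop_id)
    qed
  qed simp
  then have "G \<subseteq> {0}" using Zk[of L] by blast
  then show ?thesis
    unfolding G(3) word_span_def by (intro span_minimal) auto
qed

text \<open>
  A maximal member of the family of ideals spanned by all products and finitely many further elements
  is the whole algebra; this provides \<open>X\<close>. The words of some length \<open>L\<close> in \<open>X\<close> vanish, so the series is
  stationary at \<open>L\<close> and its term there is zero.
\<close>

theorem acc_imp_finite_spanning_set:
  assumes acc: acc_on_ideals
  shows "\<exists>S. finite S \<and> span S = UNIV"
proof -
  let ?\<F> = "{span (X \<union> lower_central 1) | X. finite X}"
  have ideal: "alg_ideal J" if mem: "J \<in> ?\<F>" for J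
  proof -
    obtain X where J: "J = span (X \<union> lower_central 1)" using mem by blast
    have "lower_central 1 \<subseteq> J" "subspace J" unfolding J using span_superset by blast+
    moreover have "x \<odot> y \<in> lower_central 1" for x y
      using mult_lower_central[of y 0 x] by simp
    ultimately show ?thesis unfolding alg_ideal_def by blast
  qed
  have "span ({} \<union> lower_central 1) \<in> ?\<F>" by blast
  then have "\<exists>M \<in> ?\<F>. \<forall>J \<in> ?\<F>. M \<subseteq> J \<longrightarrow> J = M"
    by (rule maximal_ideal_of_family[OF acc ideal, rotated])
  then obtain X where X: "finite X"
    and max: "\<And>J. J \<in> ?\<F> \<Longrightarrow> span (X \<union> lower_central 1) \<subseteq> J \<Longrightarrow> J = span (X \<union> lower_central 1)"
    by auto
  have "x \<in> span (X \<union> lower_central 1)" for x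
  proof -
    have "span (insert x X \<union> lower_central 1) \<in> ?\<F>" using X by blast
    moreover have "span (X \<union> lower_central 1) \<subseteq> span (insert x X \<union> lower_central 1)"
      by (rule span_mono) blast
    ultimately have "span (insert x X \<union> lower_central 1) = span (X \<union> lower_central 1)"
      by (rule max)
    moreover have "x \<in> span (insert x X \<union> lower_central 1)" by (rule span_base) simp
    ultimately show ?thesis by blast
  qed
  then have X1: "span (X \<union> lower_central 1) = UNIV" by blast
  obtain L where L: "\<And>ws x. set ws \<subseteq> X \<Longrightarrow> length ws = L \<Longrightarrow> act id ws x = 0"
    using finitely_many_multiplications_nilpotent[OF X] by blast
  have "monomials X L \<subseteq> {0}" using L unfolding monomials_def by blast
  then have "monomials X L \<union> lower_central (Suc L) \<subseteq> lower_central (Suc L)"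
    using subspace_0[OF subspace_lower_central] by blast
  then have "lower_central L \<subseteq> lower_central (Suc L)"
    using lower_central_subset_span[OF X1, of L] span_minimal[OF _ subspace_lower_central] by blast
  then have zero: "lower_central L \<subseteq> {0}"
    using idempotent_ideal_zero[OF acc alg_ideal_lower_central] by simp
  have span: "UNIV = span ((\<Union>k<j. monomials X k) \<union> lower_central j)" for j
  proof (induction j)
    case (Suc j)
    have "lower_central j \<subseteq> span ((\<Union>k<Suc j. monomials X k) \<union> lower_central (Suc j))"
      using lower_central_subset_span[OF X1, of j]
        span_mono[of "monomials X j \<union> lower_central (Suc j)"
          "(\<Union>k<Suc j. monomials X k) \<union> lower_central (Suc j)"] by blast
    moreover have "(\<Union>k<j. monomials X k) \<subseteq> span ((\<Union>k<Suc j. monomials X k) \<union> lower_central (Suc j))"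
      by (rule order.trans[OF _ span_superset]) (use less_SucI in blast)
    ultimately have "span ((\<Union>k<j. monomials X k) \<union> lower_central j) \<subseteq>
        span ((\<Union>k<Suc j. monomials X k) \<union> lower_central (Suc j))"
      by (intro span_minimal) auto
    then show ?case using Suc by blast
  qed simp
  have "span ((\<Union>k<L. monomials X k) \<union> {0}) = UNIV"
    using span[of L] span_mono[of "(\<Union>k<L. monomials X k) \<union> lower_central L" "(\<Union>k<L. monomials X k) \<union> {0}"]
      zero by blast
  moreover have "finite ((\<Union>k<L. monomials X k) \<union> {0})"
    using finite_monomials[OF X] by simp
  ultimately show ?thesis by blast
qed

end

section \<open>Finite dimension\<close>

lemma (in vector_space) finite_spanning_set_imp_finite_dimensional:
  assumes "finite S" "span S = UNIV"
  shows "\<exists>B. finite_dimensional_vector_space scale B"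
proof -
  obtain B where "B \<subseteq> S" "independent B" "S \<subseteq> span B"
    using maximal_independent_subset by blast
  then have "finite B" "span B = UNIV"
    using assms finite_subset span_minimal[OF _ subspace_span, of S B] by auto
  then have "finite_dimensional_vector_space scale B"
    using \<open>independent B\<close> by unfold_locales auto
  then show ?thesis by blast
qed

theorem corollary4p4:
  fixes scale :: "'k::field \<Rightarrow> 'a::ab_group_add \<Rightarrow> 'a"
    and mult :: "'a \<Rightarrow> 'a \<Rightarrow> 'a"
  assumes "infinite (UNIV :: 'k set)"
    and "CHAR('k) \<noteq> 2" and "CHAR('k) \<noteq> 3"
    and "commutative_nonassoc_algebra scale mult"
    and cube_zero: "\<And>x. mult (mult x x) x = 0"
    and "nonassoc_algebra.acc_on_ideals scale mult"
  shows "\<exists>B. finite_dimensional_vector_space scale B"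
proof -
  have "(of_nat p :: 'k) \<noteq> 0" if "prime p" "CHAR('k) \<noteq> p" for p
  proof
    assume "(of_nat p :: 'k) = 0"
    then have "CHAR('k) dvd p" by (simp add: of_nat_eq_0_iff_char_dvd)
    then show False using that CHAR_not_1 by (auto simp: prime_nat_iff)
  qed
  from this[of 2] this[of 3] have "(2 :: 'k) \<noteq> 0" "(3 :: 'k) \<noteq> 0"
    using assms(2,3) by (simp_all add: two_is_prime_nat)
  then interpret cube_zero_algebra scale mult
    using assms(4) cube_zero
    by (intro cube_zero_algebra.intro cube_zero_algebra_axioms.intro)
  obtain S where "finite S" "span S = UNIV"
    using acc_imp_finite_spanning_set assms(6) by blast
  then show ?thesis by (rule finite_spanning_set_imp_finite_dimensional)
qed

end
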